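(* Let $\mathscr{C}$ be a finite fuzzy covering on $\mathbb{U}$, let $O$ be an overlap function satisfying (O7) and let $I_O$ be its $R_O$-implicator. Let $N_1^{\mathscr{C}}$, $N_1^{\mathscr{C}_2}$ be the fuzzy neighborhood operators defined by $I_O$ and $N_4^{\mathscr{C}_1}$, $N_4^{\mathscr{C}}$ the fuzzy neighborhood operators defined by $O$. Then $N_1^{\mathscr{C}}\le N_1^{\mathscr{C}_2}$ and $N_4^{\mathscr{C}_1}\le N_4^{\mathscr{C}}$.
   Context: $\mathbb{U}$ is a non-empty set; fuzzy subsets of $\mathbb{U}$ are maps $\mathbb{U}\to[0,1]$; inclusion is pointwise $\le$. A fuzzy covering on $\mathbb{U}$ is a collection $\mathscr{C}$ of fuzzy subsets of $\mathbb{U}$, none identically $0$, such that for every $x\in\mathbb{U}$ there is $K\in\mathscr{C}$ with $K(x)=1$. For $x\in\mathbb{U}$: $\mathbb{C}(\mathscr{C},x)=\{K\in\mathscr{C}:K(x)>0\}$; $md(\mathscr{C},x)=\{K\in\mathbb{C}(\mathscr{C},x):\forall S\in\mathbb{C}(\mathscr{C},x),\ (S(x)=K(x)\text{ and }S\subseteq K)\Rightarrow S=K\}$; $MD(\mathscr{C},x)=\{K\in\mathbb{C}(\mathscr{C},x):\forall S\in\mathbb{C}(\mathscr{C},x),\ (S(x)=K(x)\text{ and }S\supseteq K)\Rightarrow S=K\}$. Derived coverings: $\mathscr{C}_1=\bigcup_{x\in\mathbb{U}}md(\mathscr{C},x)$, $\mathscr{C}_2=\bigcup_{x\in\mathbb{U}}MD(\mathscr{C},x)$.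 An overlap function is a map $O:[0,1]^2\to[0,1]$ that is commutative, increasing (non-decreasing in each argument), continuous, and satisfies $O(x,y)=0\iff xy=0$ and $O(x,y)=1\iff xy=1$. Condition (O7): $O(x,1)\le x$ for all $x\in[0,1]$. The $R_O$-implicator of $O$ is $I_O(x,y)=\max\{z\in[0,1]:O(x,z)\le y\}$. For a collection $\mathscr{D}$ of fuzzy sets and $x,y\in\mathbb{U}$: $N_1^{\mathscr{D}}(x)(y)=\inf_{K\in\mathscr{D}}I_O(K(x),K(y))$ and $N_4^{\mathscr{D}}(x)(y)=\sup_{K\in\mathscr{D}}O(K(x),K(y))$. For operators, $N\le N'$ means $N(x)(y)\le N'(x)(y)$ for all $x,y\in\mathbb{U}$. *)

theory Defs
  imports "HOL-Analysis.Analysis"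
begin

(* The universe is the type 'u (types are non-empty). Fuzzy subsets are real-valued functions with
   values in {0..1}; inclusion of fuzzy sets, and the order on neighborhood operators, is the
   library's pointwise order on functions. *)

definition fuzzy_set :: "('u \<Rightarrow> real) \<Rightarrow> bool" where
  "fuzzy_set K \<longleftrightarrow> (\<forall>x. K x \<in> {0..1})"

definition fuzzy_covering :: "('u \<Rightarrow> real) set \<Rightarrow> bool" where
  "fuzzy_covering C \<longleftrightarrow>
     (\<forall>K\<in>C. fuzzy_set K \<and> K \<noteq> (\<lambda>_. 0)) \<and> (\<forall>x. \<exists>K\<in>C. K x = 1)"

definition cov_at :: "('u \<Rightarrow> real) set \<Rightarrow> 'u \<Rightarrow> ('u \<Rightarrow> real) set" where
  "cov_at C x = {K \<in> C. K x > 0}"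

definition md :: "('u \<Rightarrow> real) set \<Rightarrow> 'u \<Rightarrow> ('u \<Rightarrow> real) set" where
  "md C x = {K \<in> cov_at C x. \<forall>S \<in> cov_at C x. S x = K x \<and> S \<le> K \<longrightarrow> S = K}"

definition MD :: "('u \<Rightarrow> real) set \<Rightarrow> 'u \<Rightarrow> ('u \<Rightarrow> real) set" where
  "MD C x = {K \<in> cov_at C x. \<forall>S \<in> cov_at C x. S x = K x \<and> S \<ge> K \<longrightarrow> S = K}"

definition cov1 :: "('u \<Rightarrow> real) set \<Rightarrow> ('u \<Rightarrow> real) set" where
  "cov1 C = (\<Union>x. md C x)"

definition cov2 :: "('u \<Rightarrow> real) set \<Rightarrow> ('u \<Rightarrow> real) set" where
  "cov2 C = (\<Union>x. MD C x)"

(* Only the values of Ov on {0..1} x {0..1} are relevant. *)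
definition overlap_function :: "(real \<Rightarrow> real \<Rightarrow> real) \<Rightarrow> bool" where
  "overlap_function Ov \<longleftrightarrow>
     (\<forall>x\<in>{0..1}. \<forall>y\<in>{0..1}. Ov x y \<in> {0..1}) \<and>
     (\<forall>x\<in>{0..1}. \<forall>y\<in>{0..1}. Ov x y = Ov y x) \<and>
     (\<forall>x\<in>{0..1}. \<forall>x'\<in>{0..1}. \<forall>y\<in>{0..1}. \<forall>y'\<in>{0..1}.
        x \<le> x' \<longrightarrow> y \<le> y' \<longrightarrow> Ov x y \<le> Ov x' y') \<and>
     continuous_on ({0..1} \<times> {0..1}) (\<lambda>(x, y). Ov x y) \<and>
     (\<forall>x\<in>{0..1}. \<forall>y\<in>{0..1}. Ov x y = 0 \<longleftrightarrow> x * y = 0) \<and>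
     (\<forall>x\<in>{0..1}. \<forall>y\<in>{0..1}. Ov x y = 1 \<longleftrightarrow> x * y = 1)"

definition O7 :: "(real \<Rightarrow> real \<Rightarrow> real) \<Rightarrow> bool" where
  "O7 Ov \<longleftrightarrow> (\<forall>x\<in>{0..1}. Ov x 1 \<le> x)"

(* The maximum is taken over a generally infinite set, hence GREATEST rather than Max. *)
definition R_implicator :: "(real \<Rightarrow> real \<Rightarrow> real) \<Rightarrow> real \<Rightarrow> real \<Rightarrow> real" where
  "R_implicator Ov x y = (GREATEST z. z \<in> {0..1} \<and> Ov x z \<le> y)"

(* For finite non-empty D, the infimum and supremum in the reals are those in [0,1]. *)
definition N1 :: "(real \<Rightarrow> real \<Rightarrow> real) \<Rightarrow> ('u \<Rightarrow> real) set \<Rightarrow> 'u \<Rightarrow> 'u \<Rightarrow> real" where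
  "N1 I D x y = (INF K\<in>D. I (K x) (K y))"

definition N4 :: "(real \<Rightarrow> real \<Rightarrow> real) \<Rightarrow> ('u \<Rightarrow> real) set \<Rightarrow> 'u \<Rightarrow> 'u \<Rightarrow> real" where
  "N4 Ov D x y = (SUP K\<in>D. Ov (K x) (K y))"

(* The maximum defining R_implicator is attained. *)
lemma R_implicator_max:
  assumes ov: "overlap_function Ov" and x: "x \<in> {0..1}" and y: "y \<in> {0..1}"
  shows "R_implicator Ov x y \<in> {0..1} \<and> Ov x (R_implicator Ov x y) \<le> y"
    and "\<And>z. z \<in> {0..1} \<Longrightarrow> Ov x z \<le> y \<Longrightarrow> z \<le> R_implicator Ov x y"
proof -
  let ?A = "{z \<in> {0..1}. Ov x z \<le> y}"
  have "continuous_on ({0..1} \<times> {0..1}) (\<lambda>(x, y). Ov x y)"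
    using ov unfolding overlap_function_def by blast
  then have "continuous_on {0..1} (\<lambda>z. case (x, z) of (x, y) \<Rightarrow> Ov x y)"
    by (rule continuous_on_compose2) (use x in \<open>auto intro!: continuous_on_Pair\<close>)
  then have "continuous_on {0..1} (Ov x)"
    by simp
  then have "closed ({0..1} \<inter> Ov x -` {..y})"
    by (intro continuous_closed_preimage) auto
  moreover have "{0..1} \<inter> Ov x -` {..y} = ?A"
    by auto
  ultimately have "closed ?A"
    by simp
  moreover have "bounded ?A"
    by (rule bounded_subset[of "{0..1}"]) auto
  ultimately have "compact ?A"
    by (simp add: compact_eq_bounded_closed)
  have "Ov x 0 = 0"
    using ov x unfolding overlap_function_def by simp
  then have "?A \<noteq> {}"
    using y by (auto intro!: exI[of _ "0::real"])
  with \<open>compact ?A\<close> obtain m where m: "m \<in> ?A" "\<forall>z\<in>?A. z \<le> m"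
    using compact_attains_sup[of ?A] by meson
  then have "R_implicator Ov x y = m"
    unfolding R_implicator_def by (intro Greatest_equality) auto
  with m show "R_implicator Ov x y \<in> {0..1} \<and> Ov x (R_implicator Ov x y) \<le> y"
    and "\<And>z. z \<in> {0..1} \<Longrightarrow> Ov x z \<le> y \<Longrightarrow> z \<le> R_implicator Ov x y"
    by auto
qed

lemma derived_coverings_nonempty:
  fixes C :: "('u \<Rightarrow> real) set"
  assumes "finite C" and "fuzzy_covering C"
  shows "cov1 C \<noteq> {}" and "cov2 C \<noteq> {}"
proof -
  fix x :: 'u
  obtain K where K: "K \<in> C" "K x = 1"
    using assms(2) unfolding fuzzy_covering_def by blast
  let ?A = "{S \<in> C. S x = 1}"
  have fin: "finite ?A" and ne: "?A \<noteq> {}"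
    using assms(1) K by auto
  obtain L where "L \<in> ?A" "\<forall>S\<in>?A. S \<le> L \<longrightarrow> L = S"
    using finite_has_minimal[OF fin ne] by blast
  then have "L \<in> md C x"
    unfolding md_def cov_at_def by auto
  then show "cov1 C \<noteq> {}"
    unfolding cov1_def by blast
  obtain M where "M \<in> ?A" "\<forall>S\<in>?A. M \<le> S \<longrightarrow> M = S"
    using finite_has_maximal[OF fin ne] by blast
  then have "M \<in> MD C x"
    unfolding MD_def cov_at_def by auto
  then show "cov2 C \<noteq> {}"
    unfolding cov2_def by blast
qed

end

theory Submission
  imports Defs
begin

text \<open>Both derived coverings are non-empty subfamilies of \<open>C\<close>. Passing to a
  smaller index set can only raise an infimum and lower a supremum, which gives the two inequalities
  via \<open>N1_antimono\<close> and \<open>N4_mono\<close>.\<close>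

lemma cov1_subset: "cov1 C \<subseteq> C"
  unfolding cov1_def md_def cov_at_def by blast

lemma cov2_subset: "cov2 C \<subseteq> C"
  unfolding cov2_def MD_def cov_at_def by blast

text \<open>The infimum is taken in the reals: finiteness of \<open>C\<close> bounds the values
  below, and \<open>D \<noteq> {}\<close> excludes the infimum of the empty set, which has no
  meaningful real value.\<close>

lemma N1_antimono:
  assumes "D \<subseteq> C" and "D \<noteq> {}" and "finite C"
  shows "N1 I C \<le> N1 I D"
  unfolding N1_def le_fun_def
  using assms by (auto intro!: cINF_superset_mono bdd_below_finite)

lemma N4_mono:
  assumes "D \<subseteq> C" and "D \<noteq> {}" and "finite C"
  shows "N4 Ov D \<le> N4 Ov C"
  unfolding N4_def le_fun_def
  using assms by (auto intro!: cSUP_subset_mono bdd_above_finite)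

theorem proposition4p7:
  fixes C :: "('u \<Rightarrow> real) set" and Ov :: "real \<Rightarrow> real \<Rightarrow> real"
  assumes "fuzzy_covering C" and "finite C"
    and "overlap_function Ov" and "O7 Ov"
  shows "N1 (R_implicator Ov) C \<le> N1 (R_implicator Ov) (cov2 C) \<and>
         N4 Ov (cov1 C) \<le> N4 Ov C"
  \<comment> \<open>Non-emptiness comes from a minimal, respectively maximal, element among the
    finitely many sets with value 1 at a point.\<close>
  using N1_antimono[OF cov2_subset] N4_mono[OF cov1_subset]
    derived_coverings_nonempty[OF assms(2,1)] assms(2) by blast

end
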